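(* Let $p\colon E\to B$ be a simplicial fibration with connected base $B$ and generic fiber $F$. Then $$\mathrm{scat}(E)+1\leq(\mathrm{scat}(B)+1)(\mathrm{scat}(F)+1).$$
   Context: Simplicial complexes are abstract simplicial complexes, not necessarily finite; simplicial maps are maps of vertex sets sending simplices to simplices. The (categorical) product $K\times L$ has vertex set $V(K)\times V(L)$, and a finite set of vertices is a simplex iff both its projections are simplices. For $m\ge1$, $I_m$ is the one-dimensional complex with vertices $0,\dots,m$ and edges $\{j,j+1\}$, $0\le j<m$. A simplicial map $p\colon E\to B$ is a simplicial fibration if for every simplicial complex $K$ (finite or not), every $m\ge1$, and all simplicial maps $H\colon K\times I_m\to B$ and $\varphi\colon K\times\{0\}\to E$ with $p(\varphi(v,0))=H(v,0)$ for all vertices $v$, there is a simplicial map $\widetilde H\colon K\times I_m\to E$ with $\widetilde H(v,0)=\varphi(v,0)$ for all $v$ and $p\circ\widetilde H=H$. $B$ is connected if any two vertices $b,b'$ of $B$ can be joined by a simplicial map $\gamma\colon I_n\to B$ with $\gamma(0)=b$, $\gamma(n)=b'$, for some $n$. Simplicial maps $\varphi,\psi\colon K\to L$ are contiguous if $\varphi(\sigma)\cup\psi(\sigma)$ is a simplex of $L$ for every simplex $\sigma$ of $K$; they are in the same contiguity class, $\varphi\sim\psi$, if they are joined by a finite sequence of simplicial maps with consecutive ones contiguous. Two complexes $K,L$ have the same strong homotopy type if there are simplicial maps $\varphi\colon K\to L$ and $\psi\colon L\to K$ with $\psi\circ\varphi\sim 1_K$ and $\varphi\circ\psi\sim1_L$.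 The simplicial LS-category $\mathrm{scat}(K)$ is the least integer $n\ge0$ such that $K$ can be covered by $n+1$ subcomplexes $K_0,\dots,K_n$ such that each inclusion $K_j\subset K$ is in the contiguity class of some constant map $K_j\to K$ (and $\infty$ if there is no such $n$). It is invariant under strong homotopy type. The fiber over a vertex $b$ of $B$ is the full subcomplex $p^{-1}(b)$ of $E$ on the vertices $e$ with $p(e)=b$. When $B$ is connected all fibers have the same strong homotopy type; the generic fiber $F$ denotes any simplicial complex with the same strong homotopy type as these fibers. *)

theory Defs
  imports Main "HOL-Library.Extended_Nat"
begin

(* A complex is its set of (finite, nonempty) simplices; its vertices are the points that
   occur in simplices, equivalently the points v for which {v} is a simplex. *)

definition simplicial_complex :: "'a set set \<Rightarrow> bool" where
  "simplicial_complex K \<longleftrightarrow>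
     (\<forall>\<sigma>\<in>K. finite \<sigma> \<and> \<sigma> \<noteq> {}) \<and> (\<forall>\<sigma>\<in>K. \<forall>\<tau>. \<tau> \<subseteq> \<sigma> \<and> \<tau> \<noteq> {} \<longrightarrow> \<tau> \<in> K)"

definition vertices :: "'a set set \<Rightarrow> 'a set" where
  "vertices K = \<Union>K"

definition subcomplex :: "'a set set \<Rightarrow> 'a set set \<Rightarrow> bool" where
  "subcomplex L K \<longleftrightarrow> simplicial_complex L \<and> L \<subseteq> K"

definition full_subcomplex :: "'a set set \<Rightarrow> 'a set \<Rightarrow> 'a set set" where
  "full_subcomplex K A = {\<sigma> \<in> K. \<sigma> \<subseteq> A}"

(* Maps are total functions on the ambient types; their values off the vertices of K are
   irrelevant. *)

definition simplicial_map :: "'a set set \<Rightarrow> 'b set set \<Rightarrow> ('a \<Rightarrow> 'b) \<Rightarrow> bool" where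
  "simplicial_map K L f \<longleftrightarrow> (\<forall>\<sigma>\<in>K. f ` \<sigma> \<in> L)"

definition product_complex :: "'a set set \<Rightarrow> 'b set set \<Rightarrow> ('a \<times> 'b) set set" where
  "product_complex K L =
     {S. finite S \<and> S \<subseteq> vertices K \<times> vertices L \<and> fst ` S \<in> K \<and> snd ` S \<in> L}"

definition interval_complex :: "nat \<Rightarrow> nat set set" where
  "interval_complex m = {{j} |j. j \<le> m} \<union> {{j, Suc j} |j. j < m}"

definition connected_complex :: "'a set set \<Rightarrow> bool" where
  "connected_complex B \<longleftrightarrow>
     (\<forall>b\<in>vertices B. \<forall>b'\<in>vertices B.
        \<exists>n\<ge>1. \<exists>\<gamma>. simplicial_map (interval_complex n) B \<gamma> \<and> \<gamma> 0 = b \<and> \<gamma> n = b')"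

definition homotopy_lifting ::
  "'e set set \<Rightarrow> 'b set set \<Rightarrow> ('e \<Rightarrow> 'b) \<Rightarrow> 'k set set \<Rightarrow> bool" where
  "homotopy_lifting E B p K \<longleftrightarrow>
     (\<forall>m\<ge>1. \<forall>(H :: 'k \<times> nat \<Rightarrow> 'b) (\<phi> :: 'k \<times> nat \<Rightarrow> 'e).
        simplicial_map (product_complex K (interval_complex m)) B H \<and>
        simplicial_map (product_complex K {{0}}) E \<phi> \<and>
        (\<forall>v\<in>vertices K. p (\<phi> (v, 0)) = H (v, 0)) \<longrightarrow>
        (\<exists>H'. simplicial_map (product_complex K (interval_complex m)) E H' \<and>
              (\<forall>v\<in>vertices K. H' (v, 0) = \<phi> (v, 0)) \<and>
              (\<forall>x\<in>vertices (product_complex K (interval_complex m)). p (H' x) = H x)))"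

(* HOL cannot quantify over types inside a definition, so the test complexes K range over the
   complexes with vertices in the type of pairs (vertex of E, map nat => B). This is no
   restriction: lemma simplicial_fibration_lifting below gives the lifting property for test
   complexes over an arbitrary type, because v |-> (phi (v, 0), H (v, _)) turns every lifting
   problem into one over this type. *)

definition simplicial_fibration :: "'e set set \<Rightarrow> 'b set set \<Rightarrow> ('e \<Rightarrow> 'b) \<Rightarrow> bool" where
  "simplicial_fibration E B p \<longleftrightarrow>
     simplicial_map E B p \<and>
     (\<forall>K :: ('e \<times> (nat \<Rightarrow> 'b)) set set. simplicial_complex K \<longrightarrow> homotopy_lifting E B p K)"

definition fiber :: "'e set set \<Rightarrow> ('e \<Rightarrow> 'b) \<Rightarrow> 'b \<Rightarrow> 'e set set" where
  "fiber E p b = full_subcomplex E {e \<in> vertices E. p e = b}"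

definition contiguous :: "'a set set \<Rightarrow> 'b set set \<Rightarrow> ('a \<Rightarrow> 'b) \<Rightarrow> ('a \<Rightarrow> 'b) \<Rightarrow> bool" where
  "contiguous K L f g \<longleftrightarrow>
     simplicial_map K L f \<and> simplicial_map K L g \<and> (\<forall>\<sigma>\<in>K. f ` \<sigma> \<union> g ` \<sigma> \<in> L)"

definition same_contiguity_class ::
  "'a set set \<Rightarrow> 'b set set \<Rightarrow> ('a \<Rightarrow> 'b) \<Rightarrow> ('a \<Rightarrow> 'b) \<Rightarrow> bool" where
  "same_contiguity_class K L f g \<longleftrightarrow>
     simplicial_map K L f \<and> simplicial_map K L g \<and> (contiguous K L)\<^sup>*\<^sup>* f g"

definition same_strong_homotopy_type :: "'a set set \<Rightarrow> 'b set set \<Rightarrow> bool" where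
  "same_strong_homotopy_type K L \<longleftrightarrow>
     (\<exists>\<phi> \<psi>. simplicial_map K L \<phi> \<and> simplicial_map L K \<psi> \<and>
        same_contiguity_class K K (\<psi> \<circ> \<phi>) id \<and> same_contiguity_class L L (\<phi> \<circ> \<psi>) id)"

definition generic_fiber ::
  "'e set set \<Rightarrow> 'b set set \<Rightarrow> ('e \<Rightarrow> 'b) \<Rightarrow> 'f set set \<Rightarrow> bool" where
  "generic_fiber E B p F \<longleftrightarrow>
     simplicial_complex F \<and> (\<forall>b\<in>vertices B. same_strong_homotopy_type F (fiber E p b))"

(* The empty map counts as constant, so the empty subcomplex is always categorical. *)

definition categorical_subcomplex :: "'a set set \<Rightarrow> 'a set set \<Rightarrow> bool" where
  "categorical_subcomplex L K \<longleftrightarrow>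
     subcomplex L K \<and> (\<exists>v. simplicial_map L K (\<lambda>_. v) \<and> same_contiguity_class L K id (\<lambda>_. v))"

definition categorical_cover :: "'a set set \<Rightarrow> nat \<Rightarrow> bool" where
  "categorical_cover K n \<longleftrightarrow>
     (\<exists>L :: nat \<Rightarrow> 'a set set. (\<forall>j\<le>n. categorical_subcomplex (L j) K) \<and> (\<Union>j\<le>n. L j) = K)"

(* The infimum of the empty set in enat is infinity. *)

definition scat :: "'a set set \<Rightarrow> enat" where
  "scat K = Inf {enat n |n. categorical_cover K n}"

lemma simplicial_fibration_lifting:
  fixes E :: "'e set set" and B :: "'b set set" and p :: "'e \<Rightarrow> 'b" and K :: "'k set set"
  assumes B: "simplicial_complex B" and E: "simplicial_complex E"
    and fib: "simplicial_fibration E B p" and K: "simplicial_complex K"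
  shows "homotopy_lifting E B p K"
  unfolding homotopy_lifting_def
proof (intro allI impI, elim conjE)
  fix m :: nat and H :: "'k \<times> nat \<Rightarrow> 'b" and \<phi> :: "'k \<times> nat \<Rightarrow> 'e"
  assume m: "1 \<le> m"
    and H: "simplicial_map (product_complex K (interval_complex m)) B H"
    and \<phi>: "simplicial_map (product_complex K {{0}}) E \<phi>"
    and eq: "\<forall>v\<in>vertices K. p (\<phi> (v, 0)) = H (v, 0)"
  let ?I = "interval_complex m"
  define q where "q v = (\<phi> (v, 0), \<lambda>j. H (v, j))" for v
  define Q where "Q = (\<lambda>\<sigma>. q ` \<sigma>) ` K"
  define G where "G = (\<lambda>((e :: 'e, \<gamma> :: nat \<Rightarrow> 'b), j :: nat). \<gamma> j)"
  define \<psi> where "\<psi> = (\<lambda>((e :: 'e, \<gamma> :: nat \<Rightarrow> 'b), j :: nat). e)"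
  have fin: "finite \<sigma>" "\<sigma> \<noteq> {}" if "\<sigma> \<in> K" for \<sigma>
    using K that by (auto simp: simplicial_complex_def)
  have finI: "finite \<tau>" "\<tau> \<noteq> {}" if "\<tau> \<in> ?I" for \<tau>
    using that by (auto simp: interval_complex_def)
  have Q: "simplicial_complex Q"
    unfolding simplicial_complex_def
  proof (intro conjI ballI allI impI)
    fix \<sigma> assume "\<sigma> \<in> Q"
    then show "finite \<sigma>" "\<sigma> \<noteq> {}" using fin by (auto simp: Q_def)
  next
    fix \<sigma> \<tau> assume "\<sigma> \<in> Q" and t: "\<tau> \<subseteq> \<sigma> \<and> \<tau> \<noteq> {}"
    then obtain \<rho> where r: "\<rho> \<in> K" "\<sigma> = q ` \<rho>" by (auto simp: Q_def)
    with t obtain \<rho>' where r': "\<rho>' \<subseteq> \<rho>" "\<tau> = q ` \<rho>'" by (meson subset_imageE)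
    with t have "\<rho>' \<noteq> {}" by auto
    with r r' K have "\<rho>' \<in> K" unfolding simplicial_complex_def by blast
    with r' show "\<tau> \<in> Q" by (auto simp: Q_def)
  qed
  have verQ: "q v \<in> vertices Q" if "v \<in> vertices K" for v
    using that by (auto simp: vertices_def Q_def)
  have prodK: "\<sigma> \<times> \<tau> \<in> product_complex K J"
    if "\<sigma> \<in> K" "\<tau> \<in> J" "finite \<tau>" "\<tau> \<noteq> {}" for \<sigma> \<tau> and J :: "nat set set"
    using that fin[of \<sigma>] by (auto simp: product_complex_def vertices_def)
  have G: "simplicial_map (product_complex Q ?I) B G"
    unfolding simplicial_map_def
  proof
    fix S assume S: "S \<in> product_complex Q ?I"
    then obtain \<sigma> where s: "\<sigma> \<in> K" "fst ` S = q ` \<sigma>" by (auto simp: product_complex_def Q_def)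
    have t: "snd ` S \<in> ?I" using S by (auto simp: product_complex_def)
    have "H ` (\<sigma> \<times> snd ` S) \<in> B"
      using H prodK[OF s(1) t finI[OF t]] by (auto simp: simplicial_map_def)
    moreover have "G ` S \<subseteq> H ` (\<sigma> \<times> snd ` S)"
    proof
      fix y assume "y \<in> G ` S"
      then obtain x where x: "x \<in> S" "y = G x" by auto
      then have "fst x \<in> q ` \<sigma>" using s(2) by (metis imageI)
      then obtain v where v: "v \<in> \<sigma>" "fst x = q v" by auto
      then have "y = H (v, snd x)" using x(2) by (cases x) (simp add: G_def q_def)
      then show "y \<in> H ` (\<sigma> \<times> snd ` S)" using x v by blast
    qed
    moreover have "G ` S \<noteq> {}" using finI(2)[OF t] by auto
    ultimately show "G ` S \<in> B" using B unfolding simplicial_complex_def by blast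
  qed
  have \<psi>: "simplicial_map (product_complex Q {{0::nat}}) E \<psi>"
    unfolding simplicial_map_def
  proof
    fix S assume S: "S \<in> product_complex Q {{0::nat}}"
    then obtain \<sigma> where s: "\<sigma> \<in> K" "fst ` S = q ` \<sigma>" by (auto simp: product_complex_def Q_def)
    have ph: "\<phi> ` (\<sigma> \<times> {0}) \<in> E"
      using \<phi> prodK[OF s(1), of "{0}" "{{0}}"] by (auto simp: simplicial_map_def)
    have "\<psi> ` S = fst ` (fst ` S)" by (auto simp: \<psi>_def image_iff) force+
    also have "\<dots> = \<phi> ` (\<sigma> \<times> {0})" unfolding s(2) by (auto simp: q_def image_iff)
    finally show "\<psi> ` S \<in> E" using ph by simp
  qed
  have eq': "\<forall>v\<in>vertices Q. p (\<psi> (v, 0)) = G (v, 0)"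
    using eq by (auto simp: Q_def vertices_def \<psi>_def G_def q_def)
  have "homotopy_lifting E B p Q"
    using fib Q unfolding simplicial_fibration_def by blast
  then obtain G' where G': "simplicial_map (product_complex Q ?I) E G'"
      "\<forall>v\<in>vertices Q. G' (v, 0) = \<psi> (v, 0)"
      "\<forall>x\<in>vertices (product_complex Q ?I). p (G' x) = G x"
    unfolding homotopy_lifting_def using m G \<psi> eq' by blast
  let ?q = "\<lambda>x. (q (fst x), snd x)"
  have qS: "?q ` S \<in> product_complex Q ?I" if "S \<in> product_complex K ?I" for S
  proof -
    have "fst ` ?q ` S = q ` (fst ` S)" "snd ` ?q ` S = snd ` S" by (auto simp: image_image)
    moreover have "?q ` S \<subseteq> vertices Q \<times> vertices ?I"
      using that verQ by (auto simp: product_complex_def)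
    ultimately show ?thesis using that by (simp add: product_complex_def Q_def)
  qed
  have "simplicial_map (product_complex K ?I) E (G' \<circ> ?q)"
    unfolding simplicial_map_def
  proof
    fix S assume "S \<in> product_complex K ?I"
    then have "G' ` (?q ` S) \<in> E" using G'(1) qS unfolding simplicial_map_def by blast
    then show "(G' \<circ> ?q) ` S \<in> E" by (simp only: image_comp)
  qed
  moreover have "\<forall>v\<in>vertices K. (G' \<circ> ?q) (v, 0) = \<phi> (v, 0)"
    using G'(2) verQ by (simp add: \<psi>_def q_def)
  moreover have "\<forall>x\<in>vertices (product_complex K ?I). p ((G' \<circ> ?q) x) = H x"
  proof
    fix x assume "x \<in> vertices (product_complex K ?I)"
    then have "?q x \<in> vertices (product_complex Q ?I)"
      using qS unfolding vertices_def by blast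
    then have "p (G' (?q x)) = G (?q x)" using G'(3) by blast
    also have "\<dots> = H x" by (simp add: G_def q_def)
    finally show "p ((G' \<circ> ?q) x) = H x" by simp
  qed
  ultimately show "\<exists>H'. simplicial_map (product_complex K ?I) E H' \<and>
      (\<forall>v\<in>vertices K. H' (v, 0) = \<phi> (v, 0)) \<and>
      (\<forall>x\<in>vertices (product_complex K ?I). p (H' x) = H x)" by blast
qed

end

theory Submission
  imports Defs
begin

text \<open>
  If \<open>U\<close> is categorical in \<open>B\<close>, lifting the contiguity chain from the inclusion of \<open>U\<close> to a
  constant \<open>b\<close>, precomposed with \<open>p\<close>, deforms \<open>p\<^sup>-\<^sup>1(U)\<close> inside \<open>E\<close> into the fiber over \<open>b\<close>. Pulling
  back a categorical cover of \<open>F\<close> along \<open>p\<^sup>-\<^sup>1(U) \<rightarrow> p\<^sup>-\<^sup>1(b) \<rightarrow> F\<close> splits \<open>p\<^sup>-\<^sup>1(U)\<close> into pieces that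
  are categorical in \<open>E\<close>, because the composite back into \<open>E\<close> is still in the contiguity class of
  the inclusion.
\<close>

section \<open>Preimages and contiguity classes\<close>

text \<open>The condition is on whole simplices: as \<open>L\<close> need not be full, this can be
  smaller than the full subcomplex on the vertices that \<open>f\<close> sends into
  \<open>L\<close>.\<close>

definition preimage_complex :: "'a set set \<Rightarrow> ('a \<Rightarrow> 'b) \<Rightarrow> 'b set set \<Rightarrow> 'a set set" where
  "preimage_complex K f L = {\<sigma> \<in> K. f ` \<sigma> \<in> L}"

lemma simplicial_complex_subset:
  assumes "simplicial_complex K" "\<sigma> \<in> K" "\<tau> \<subseteq> \<sigma>" "\<tau> \<noteq> {}"
  shows "\<tau> \<in> K"
  using assms unfolding simplicial_complex_def by blast

lemma subcomplex_preimage_complex: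
  assumes "simplicial_complex K" and "simplicial_complex L"
  shows "subcomplex (preimage_complex K f L) K"
  unfolding subcomplex_def simplicial_complex_def
proof (intro conjI ballI allI impI)
  fix \<sigma> \<tau> assume \<sigma>: "\<sigma> \<in> preimage_complex K f L" and \<tau>: "\<tau> \<subseteq> \<sigma> \<and> \<tau> \<noteq> {}"
  then have "\<tau> \<in> K" "f ` \<tau> \<in> L"
    using simplicial_complex_subset[OF assms(1), of \<sigma> \<tau>]
      simplicial_complex_subset[OF assms(2), of "f ` \<sigma>" "f ` \<tau>"]
    by (auto simp: preimage_complex_def)
  then show "\<tau> \<in> preimage_complex K f L" by (simp add: preimage_complex_def)
qed (use assms(1) in \<open>auto simp: preimage_complex_def simplicial_complex_def\<close>)

lemma simplicial_map_comp:
  assumes "simplicial_map K L f" and "simplicial_map L M g"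
  shows "simplicial_map K M (g \<circ> f)"
  using assms unfolding simplicial_map_def image_comp[symmetric] by blast

lemma contiguous_comp:
  assumes "contiguous K L f g" and "simplicial_map K' K h" and "simplicial_map L L' k"
  shows "contiguous K' L' (k \<circ> f \<circ> h) (k \<circ> g \<circ> h)"
  using assms
  unfolding contiguous_def simplicial_map_def image_comp[symmetric] image_Un[symmetric] by blast

lemma same_contiguity_class_comp:
  assumes fg: "same_contiguity_class K L f g"
    and h: "simplicial_map K' K h" and k: "simplicial_map L L' k"
  shows "same_contiguity_class K' L' (k \<circ> f \<circ> h) (k \<circ> g \<circ> h)"
proof -
  from fg have "(contiguous K L)\<^sup>*\<^sup>* f g" by (simp add: same_contiguity_class_def)
  then have "(contiguous K' L')\<^sup>*\<^sup>* (k \<circ> f \<circ> h) (k \<circ> g \<circ> h)"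
    by induction (blast intro: rtranclp.rtrancl_into_rtrancl contiguous_comp[OF _ h k])+
  with fg show ?thesis
    unfolding same_contiguity_class_def
    by (blast intro: simplicial_map_comp[OF h] simplicial_map_comp[OF _ k])
qed

lemma same_contiguity_class_sym:
  assumes "same_contiguity_class K L f g"
  shows "same_contiguity_class K L g f"
proof -
  have "symp (contiguous K L)" by (auto simp: symp_def contiguous_def Un_commute)
  then have "symp (contiguous K L)\<^sup>*\<^sup>*" by (rule symp_rtranclp)
  with assms show ?thesis by (auto simp: same_contiguity_class_def dest: sympD)
qed

lemma same_contiguity_class_trans:
  assumes "same_contiguity_class K L f g" and "same_contiguity_class K L g h"
  shows "same_contiguity_class K L f h"
  using assms by (auto simp: same_contiguity_class_def)

text \<open>Restricted to the preimage, \<open>ba\<close> joins the inclusion to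
  \<open>b \<circ> a\<close>. There \<open>a\<close> takes values in \<open>V\<close>, so
  contracting \<open>V\<close> inside \<open>F\<close> and applying \<open>b\<close> continues the
  chain to the constant at \<open>b v\<close>.\<close>

lemma categorical_preimage_complex:
  assumes M: "simplicial_complex M" "M \<subseteq> E"
    and a: "simplicial_map M F a" and b: "simplicial_map F E b"
    and ba: "same_contiguity_class M E id (b \<circ> a)"
    and V: "categorical_subcomplex V F"
  shows "categorical_subcomplex (preimage_complex M a V) E"
proof -
  let ?P = "preimage_complex M a V"
  from V obtain v where "simplicial_complex V"
    and v: "same_contiguity_class V F id (\<lambda>_. v)"
    by (auto simp: categorical_subcomplex_def subcomplex_def)
  with M have sub: "subcomplex ?P E"
    using subcomplex_preimage_complex[of M V a] by (auto simp: subcomplex_def)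
  have "simplicial_map ?P M id" "simplicial_map E E id" "simplicial_map ?P V a"
    by (auto simp: simplicial_map_def preimage_complex_def)
  then have "same_contiguity_class ?P E id (b \<circ> a)"
    and "same_contiguity_class ?P E (b \<circ> a) (\<lambda>_. b v)"
    using same_contiguity_class_comp[OF ba, of ?P id E id]
      same_contiguity_class_comp[OF v, of ?P a E b] b
    by (simp_all add: comp_def id_def)
  then have "same_contiguity_class ?P E id (\<lambda>_. b v)" by (rule same_contiguity_class_trans)
  with sub show ?thesis
    by (auto simp: categorical_subcomplex_def same_contiguity_class_def)
qed

section \<open>Lifting contiguity chains along a fibration\<close>

text \<open>A contiguous pair amounts to a homotopy of length one, because the categorical product
  with \<open>interval_complex 1\<close> contains each prism \<open>\<sigma> \<times> {0, 1}\<close>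
  as a single simplex. The two ends of a lifted homotopy are therefore contiguous again.\<close>

lemma simplicial_fibration_lift_contiguous:
  fixes L :: "'a set set"
  assumes E: "simplicial_complex E" and B: "simplicial_complex B"
    and fib: "simplicial_fibration E B p" and L: "simplicial_complex L"
    and h: "contiguous L B h h'"
    and g: "simplicial_map L E g" and pg: "\<forall>v\<in>vertices L. p (g v) = h v"
  shows "\<exists>g'. contiguous L E g g' \<and> (\<forall>v\<in>vertices L. p (g' v) = h' v)"
proof -
  let ?I = "interval_complex 1"
  define H where "H x = (if snd x = 0 then h (fst x) else h' (fst x))" for x :: "'a \<times> nat"
  have I: "{0, 1} \<in> ?I" by (auto simp: interval_complex_def)
  have prod: "\<sigma> \<times> {0, 1} \<in> product_complex L ?I" if "\<sigma> \<in> L" for \<sigma>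
  proof -
    have "finite \<sigma>" "\<sigma> \<noteq> {}" using L that by (auto simp: simplicial_complex_def)
    moreover have "\<sigma> \<subseteq> vertices L" "{0, 1} \<subseteq> vertices ?I"
      using that I unfolding vertices_def by blast+
    ultimately show ?thesis
      using that I by (simp add: product_complex_def Sigma_mono)
  qed
  have "simplicial_map (product_complex L ?I) B H"
    unfolding simplicial_map_def
  proof
    fix S assume "S \<in> product_complex L ?I"
    then have S: "fst ` S \<in> L" by (simp add: product_complex_def)
    then have "S \<noteq> {}" using L by (auto simp: simplicial_complex_def)
    moreover have "H ` S \<subseteq> h ` fst ` S \<union> h' ` fst ` S" by (auto simp: H_def)
    moreover have "h ` fst ` S \<union> h' ` fst ` S \<in> B" using h S unfolding contiguous_def by blast
    ultimately show "H ` S \<in> B" using simplicial_complex_subset[OF B] by blast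
  qed
  moreover have "simplicial_map (product_complex L {{0}}) E (g \<circ> fst)"
    using g unfolding simplicial_map_def product_complex_def image_comp[symmetric] by blast
  moreover have "\<forall>v\<in>vertices L. p ((g \<circ> fst) (v, 0::nat)) = H (v, 0)"
    using pg by (simp add: H_def)
  ultimately obtain H' where H': "simplicial_map (product_complex L ?I) E H'"
      "\<forall>v\<in>vertices L. H' (v, 0) = (g \<circ> fst) (v, 0::nat)"
      "\<forall>x\<in>vertices (product_complex L ?I). p (H' x) = H x"
    using simplicial_fibration_lifting[OF B E fib L, unfolded homotopy_lifting_def, rule_format,
        of 1 H "g \<circ> fst"]
    by auto
  \<comment> \<open>The far end of the lift. The near end agrees with \<open>g\<close>, but only on
    the vertices of \<open>L\<close>.\<close>
  define g' where "g' v = H' (v, 1)" for v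
  have un: "g ` \<sigma> \<union> g' ` \<sigma> \<in> E" if "\<sigma> \<in> L" for \<sigma>
  proof -
    have "H' ` (\<sigma> \<times> {0, 1}) \<in> E" using H'(1) prod[OF that] by (simp add: simplicial_map_def)
    moreover have "g ` \<sigma> = (\<lambda>v. H' (v, 0)) ` \<sigma>"
      using H'(2) that by (intro image_cong) (auto simp: vertices_def)
    then have "H' ` (\<sigma> \<times> {0, 1}) = g ` \<sigma> \<union> g' ` \<sigma>" by (auto simp: g'_def)
    ultimately show ?thesis by simp
  qed
  have "g' ` \<sigma> \<in> E" if "\<sigma> \<in> L" for \<sigma>
    using simplicial_complex_subset[OF E un[OF that], of "g' ` \<sigma>"] L that
    by (auto simp: simplicial_complex_def)
  with g un have "contiguous L E g g'" by (simp add: contiguous_def simplicial_map_def)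
  moreover have "p (g' v) = h' v" if "v \<in> vertices L" for v
  proof -
    have "(v, 1) \<in> vertices (product_complex L ?I)"
      using that prod unfolding vertices_def by blast
    with H'(3) show ?thesis by (auto simp: g'_def H_def)
  qed
  ultimately show ?thesis by blast
qed

text \<open>Each lifted map lies exactly over its target, so it can serve as the starting point for
  lifting the next link of the chain.\<close>

lemma simplicial_fibration_lift_contiguity_class:
  assumes E: "simplicial_complex E" and B: "simplicial_complex B"
    and fib: "simplicial_fibration E B p" and L: "simplicial_complex L"
    and h: "same_contiguity_class L B h h'"
    and g: "simplicial_map L E g" and pg: "\<forall>v\<in>vertices L. p (g v) = h v"
  shows "\<exists>g'. same_contiguity_class L E g g' \<and> (\<forall>v\<in>vertices L. p (g' v) = h' v)"
proof -
  from h have "(contiguous L B)\<^sup>*\<^sup>* h h'" by (simp add: same_contiguity_class_def)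
  then show ?thesis
  proof induction
    case base
    show ?case using g pg by (auto simp: same_contiguity_class_def)
  next
    case (step k k')
    then obtain g1 where g1: "same_contiguity_class L E g g1" "\<forall>v\<in>vertices L. p (g1 v) = k v"
      by blast
    then have "simplicial_map L E g1" by (simp add: same_contiguity_class_def)
    from simplicial_fibration_lift_contiguous[OF E B fib L step.hyps(2) this g1(2)]
    obtain g2 where g2: "contiguous L E g1 g2" "\<forall>v\<in>vertices L. p (g2 v) = k' v" by blast
    then have "same_contiguity_class L E g1 g2"
      by (auto simp: same_contiguity_class_def contiguous_def)
    with g1 g2 show ?case by (blast intro: same_contiguity_class_trans)
  qed
qed

section \<open>Deformation into the generic fiber\<close>

lemma preimage_deforms_through_generic_fiber:
  assumes E: "simplicial_complex E" and B: "simplicial_complex B"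
    and fib: "simplicial_fibration E B p" and F: "generic_fiber E B p F"
    and U: "categorical_subcomplex U B" and ne: "U \<noteq> {}"
  shows "\<exists>a c. simplicial_map (preimage_complex E p U) F a \<and> simplicial_map F E c \<and>
    same_contiguity_class (preimage_complex E p U) E id (c \<circ> a)"
proof -
  let ?M = "preimage_complex E p U"
  from U obtain b where sU: "simplicial_complex U"
    and const: "simplicial_map U B (\<lambda>_. b)" and b: "same_contiguity_class U B id (\<lambda>_. b)"
    by (auto simp: categorical_subcomplex_def subcomplex_def)
  let ?Fb = "fiber E p b"
  \<comment> \<open>A simplex of \<open>U\<close> forces \<open>b\<close> to be a vertex of
    \<open>B\<close>, where \<open>generic_fiber\<close> gives information. For empty
    \<open>U\<close> the point \<open>b\<close> would be arbitrary.\<close>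
  from ne obtain \<sigma> where "\<sigma> \<in> U" by blast
  moreover from this have "\<sigma> \<noteq> {}" using sU by (auto simp: simplicial_complex_def)
  ultimately have "{b} \<in> B" using const by (metis image_constant_conv simplicial_map_def)
  then have "b \<in> vertices B" by (auto simp: vertices_def)
  with F obtain f k where f: "simplicial_map F ?Fb f" and k: "simplicial_map ?Fb F k"
    and fk: "same_contiguity_class ?Fb ?Fb (f \<circ> k) id"
    by (auto simp: generic_fiber_def same_strong_homotopy_type_def)
  have M: "simplicial_complex ?M"
    using subcomplex_preimage_complex[OF E sU] by (simp add: subcomplex_def)
  have "simplicial_map ?M U p" "simplicial_map B B id" "simplicial_map ?M E id"
    by (auto simp: simplicial_map_def preimage_complex_def)
  \<comment> \<open>Precomposing the contraction of \<open>U\<close> with \<open>p\<close> gives a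
    chain in \<open>B\<close> that starts at \<open>p\<close>. The inclusion of \<open>?M\<close>
    lies over \<open>p\<close>, so the lifted chain starts there.\<close>
  moreover from this have "same_contiguity_class ?M B p (\<lambda>_. b)"
    using same_contiguity_class_comp[OF b, of ?M p B id] by (simp add: comp_def)
  ultimately obtain g where g: "same_contiguity_class ?M E id g"
    and pg: "\<forall>v\<in>vertices ?M. p (g v) = b"
    using simplicial_fibration_lift_contiguity_class[OF E B fib M, of p "\<lambda>_. b" id] by auto
  have gF: "simplicial_map ?M ?Fb g"
    unfolding simplicial_map_def
  proof
    fix \<sigma> assume \<sigma>: "\<sigma> \<in> ?M"
    then have gE: "g ` \<sigma> \<in> E" using g by (simp add: same_contiguity_class_def simplicial_map_def)
    have "p (g v) = b" if "v \<in> \<sigma>" for v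
      using pg \<sigma> that unfolding vertices_def by blast
    with gE show "g ` \<sigma> \<in> ?Fb"
      unfolding fiber_def full_subcomplex_def vertices_def by blast
  qed
  have inc: "simplicial_map ?Fb E id"
    by (auto simp: simplicial_map_def fiber_def full_subcomplex_def)
  \<comment> \<open>The equivalence \<open>f \<circ> k \<sim> id\<close> on the fiber, reversed and
    precomposed with \<open>g\<close>, routes the deformation through \<open>F\<close>: the
    witnesses are \<open>a = k \<circ> g\<close> and \<open>c = f\<close>.\<close>
  have "same_contiguity_class ?M E g (f \<circ> (k \<circ> g))"
    using same_contiguity_class_comp[OF same_contiguity_class_sym[OF fk] gF inc]
    by (simp add: comp_assoc)
  with g have "same_contiguity_class ?M E id (f \<circ> (k \<circ> g))"
    by (rule same_contiguity_class_trans)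
  moreover have "simplicial_map F E f" using simplicial_map_comp[OF f inc] by simp
  ultimately show ?thesis using simplicial_map_comp[OF gF k] by blast
qed

section \<open>Assembling the cover of \<open>E\<close>\<close>

lemma categorical_cover_preimage:
  assumes E: "simplicial_complex E" and B: "simplicial_complex B"
    and fib: "simplicial_fibration E B p" and F: "generic_fiber E B p F"
    and U: "categorical_subcomplex U B" and m: "categorical_cover F m"
  shows "\<exists>W. (\<forall>j\<le>m. categorical_subcomplex (W j) E) \<and> (\<Union>j\<le>m. W j) = preimage_complex E p U"
proof (cases "U = {}")
  case True
  \<comment> \<open>With \<open>U\<close> empty there is no fiber to deform into, but the preimage
    is empty too and copies of the empty complex cover it.\<close>
  have "categorical_subcomplex {} E"
    by (auto simp: categorical_subcomplex_def subcomplex_def simplicial_complex_def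
        simplicial_map_def same_contiguity_class_def contiguous_def intro!: r_into_rtranclp)
  with True show ?thesis by (intro exI[of _ "\<lambda>_. {}"]) (simp add: preimage_complex_def)
next
  case False
  let ?M = "preimage_complex E p U"
  obtain a c where a: "simplicial_map ?M F a" and c: "simplicial_map F E c"
    and ca: "same_contiguity_class ?M E id (c \<circ> a)"
    using preimage_deforms_through_generic_fiber[OF E B fib F U False] by blast
  obtain V where V: "\<And>j. j \<le> m \<Longrightarrow> categorical_subcomplex (V j) F" and UV: "(\<Union>j\<le>m. V j) = F"
    using m by (auto simp: categorical_cover_def)
  have "simplicial_complex U" using U by (simp add: categorical_subcomplex_def subcomplex_def)
  then have M: "simplicial_complex ?M" "?M \<subseteq> E"
    using subcomplex_preimage_complex[OF E] by (auto simp: subcomplex_def)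
  have "(\<Union>j\<le>m. preimage_complex ?M a (V j)) = preimage_complex ?M a F"
    unfolding UV[symmetric] by (auto simp: preimage_complex_def)
  also have "\<dots> = ?M" using a by (auto simp: preimage_complex_def simplicial_map_def)
  finally show ?thesis
    using categorical_preimage_complex[OF M a c ca V]
    by (intro exI[of _ "\<lambda>j. preimage_complex ?M a (V j)"]) simp
qed

lemma categorical_cover_total_complex:
  assumes E: "simplicial_complex E" and B: "simplicial_complex B"
    and fib: "simplicial_fibration E B p" and F: "generic_fiber E B p F"
    and n: "categorical_cover B n" and m: "categorical_cover F m"
  shows "categorical_cover E (Suc n * Suc m - 1)"
proof -
  obtain U where U: "\<And>i. i \<le> n \<Longrightarrow> categorical_subcomplex (U i) B" and UU: "(\<Union>i\<le>n. U i) = B"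
    using n by (auto simp: categorical_cover_def)
  \<comment> \<open>Bundles the requirements on one family, so that a family can be chosen for every
    \<open>i\<close> at once.\<close>
  define good where "good i X \<longleftrightarrow> (\<forall>j\<le>m. categorical_subcomplex (X j) E) \<and>
    (\<Union>j\<le>m. X j) = preimage_complex E p (U i)" for i X
  have "\<exists>X. good i X" if "i \<le> n" for i
    unfolding good_def using E B fib F U[OF that] m by (rule categorical_cover_preimage)
  then obtain W where "\<And>i. i \<le> n \<Longrightarrow> good i (W i)" by metis
  then have W: "\<And>i j. i \<le> n \<Longrightarrow> j \<le> m \<Longrightarrow> categorical_subcomplex (W i j) E"
    and UW: "\<And>i. i \<le> n \<Longrightarrow> (\<Union>j\<le>m. W i j) = preimage_complex E p (U i)"
    by (simp_all add: good_def)
  \<comment> \<open>The pair \<open>(i, j)\<close> is coded as \<open>i * Suc m + j\<close>, with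
    last index \<open>Suc n * Suc m - 1\<close>.\<close>
  define L where "L k = W (k div Suc m) (k mod Suc m)" for k
  have idx: "k div Suc m \<le> n" "k mod Suc m \<le> m" if "k \<le> Suc n * Suc m - 1" for k
  proof -
    have "k < Suc n * Suc m" using that by simp
    then have "k div Suc m < Suc n" by (rule less_mult_imp_div_less)
    then show "k div Suc m \<le> n" by (rule less_Suc_eq_le[THEN iffD1])
    show "k mod Suc m \<le> m" by (rule mod_Suc_le_divisor)
  qed
  have L: "categorical_subcomplex (L k) E" if "k \<le> Suc n * Suc m - 1" for k
    using W idx[OF that] by (simp add: L_def)
  moreover have "(\<Union>k\<le>Suc n * Suc m - 1. L k) = E"
  proof
    show "(\<Union>k\<le>Suc n * Suc m - 1. L k) \<subseteq> E"
      using L by (fastforce simp: categorical_subcomplex_def subcomplex_def)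
    show "E \<subseteq> (\<Union>k\<le>Suc n * Suc m - 1. L k)"
    proof
      fix \<sigma> assume s: "\<sigma> \<in> E"
      then have "p ` \<sigma> \<in> B" using fib by (simp add: simplicial_fibration_def simplicial_map_def)
      then obtain i where i: "i \<le> n" "p ` \<sigma> \<in> U i" using UU by blast
      with s have "\<sigma> \<in> preimage_complex E p (U i)" by (simp add: preimage_complex_def)
      then obtain j where j: "j \<le> m" "\<sigma> \<in> W i j" using UW[OF i(1)] by blast
      let ?k = "i * Suc m + j"
      have "?k div Suc m = i" "?k mod Suc m = j"
        using j(1) div_mult_self3[of "Suc m" i j] mod_mult_self3[of i "Suc m" j]
        by (simp_all del: mult_Suc_right)
      then have "\<sigma> \<in> L ?k" using j(2) by (simp add: L_def)
      moreover have "?k \<le> Suc n * Suc m - 1"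
        using mult_le_mono1[OF i(1), of "Suc m"] j(1) by simp
      ultimately show "\<sigma> \<in> (\<Union>k\<le>Suc n * Suc m - 1. L k)" by blast
    qed
  qed
  ultimately show ?thesis unfolding categorical_cover_def by blast
qed

section \<open>From covers to \<open>scat\<close>\<close>

lemma scat_le: "categorical_cover K n \<Longrightarrow> scat K \<le> enat n"
  unfolding scat_def by (rule Inf_lower) blast

text \<open>\<open>enat\<close> is well-ordered, so the infimum of a nonempty set is
  attained.\<close>

lemma scat_cases:
  obtains "scat K = \<infinity>" | n where "categorical_cover K n" "scat K = enat n"
proof (cases "\<exists>n. categorical_cover K n")
  case True
  then have "Inf {enat n |n. categorical_cover K n} \<in> {enat n |n. categorical_cover K n}"
    by (metis (mono_tags, lifting) mem_Collect_eq wellorder_InfI)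
  then show thesis using that(2) by (auto simp: scat_def)
next
  case False
  then have "scat K = \<infinity>" by (simp add: scat_def Inf_enat_def)
  then show thesis by (rule that(1))
qed

theorem theorem8p2:
  fixes E :: "'e set set" and B :: "'b set set" and F :: "'f set set" and p :: "'e \<Rightarrow> 'b"
  assumes "simplicial_complex E" and "simplicial_complex B"
    and "simplicial_fibration E B p"
    and "connected_complex B"
    and "generic_fiber E B p F"
  shows "scat E + 1 \<le> (scat B + 1) * (scat F + 1)"
proof (cases "scat B = \<infinity> \<or> scat F = \<infinity>")
  case True
  \<comment> \<open>Both factors are nonzero, so one infinite factor makes the product
    infinite.\<close>
  then have "(scat B + 1) * (scat F + 1) = \<infinity>" by (auto simp: imult_is_infinity)
  then show ?thesis by simp
next
  case False
  obtain n where n: "categorical_cover B n" "scat B = enat n"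
    using False by (rule_tac K = B in scat_cases) auto
  obtain m where m: "categorical_cover F m" "scat F = enat m"
    using False by (rule_tac K = F in scat_cases) auto
  \<comment> \<open>As \<open>Suc n * Suc m\<close> is positive, the truncated subtraction is exact
    and adding 1 undoes it.\<close>
  have "scat E + 1 \<le> enat (Suc n * Suc m - 1) + 1"
    using scat_le[OF categorical_cover_total_complex[OF assms(1-3,5) n(1) m(1)]]
    by (rule add_right_mono)
  also have "\<dots> = enat (Suc n) * enat (Suc m)" by (simp add: one_enat_def)
  also have "\<dots> = (scat B + 1) * (scat F + 1)" by (simp add: n(2) m(2) one_enat_def)
  finally show ?thesis .
qed

end
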